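(* Let $m\ge 1$ be an integer and let $W$ be an arbitrary B-DMC. For every $\delta\in(0,1)$, $$\lim_{n\to\infty}\frac{\bigl|\{\mathbf s\in\mathcal S_n:\ I(W_{\mathbf s})\in(1-\delta,1]\}\bigr|}{N(n)}=I(W) \quad\text{and}\quad \lim_{n\to\infty}\frac{\bigl|\{\mathbf s\in\mathcal S_n:\ I(W_{\mathbf s})\in[0,\delta)\}\bigr|}{N(n)}=1-I(W).$$ Equivalently, if $\mathbf S_n$ is uniformly distributed on $\mathcal S_n$ and $I_n=I(W_{\mathbf S_n})$, then $\Pr(I_n>1-\delta)\to I(W)$ and $\Pr(I_n<\delta)\to 1-I(W)$.
   Context: Fix an integer $m\ge1$. Define integers $N(n)$ by $N(n)=1$ for $1-m\le n\le 0$ and $N(n)=N(n-1)+N(n-m)$ for $n\ge1$; write $\mathbb N_n=\{1,\dots,N(n)\}$ (so $\mathbb N_n=\{1\}$ for $n\le 0$, and $\mathbb N_{n-m}\subseteq\mathbb N_{n-1}$). Define vectors $\mathbf s_n^{(i)}\in\{+,-,\bigstar\}^n$ for $n\ge0$, $i\in\mathbb N_n$, recursively: $\mathbf s_0^{(1)}$ is the empty vector, and for $n\ge1$: $\mathbf s_n^{(j)}=(\mathbf s_{n-1}^{(j)},+)$ and $\mathbf s_n^{(j+N(n-1))}=(\mathbf s_{n-1}^{(j)},-)$ for $j\in\mathbb N_{n-m}$, while $\mathbf s_n^{(j)}=(\mathbf s_{n-1}^{(j)},\bigstar)$ for $j\in\mathbb N_{n-1}\setminus\mathbb N_{n-m}$.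 Let $\mathcal S_n=\{\mathbf s_n^{(i)}:i\in\mathbb N_n\}$ for $n\ge1$. A B-DMC $V$ is a channel with input alphabet $\{0,1\}$, a finite output alphabet $\mathcal Y$ and transition probabilities $V(y|x)$. With base-2 logarithms and uniform input: $I(V)=\sum_{y}\sum_{x}\frac12V(y|x)\log\frac{V(y|x)}{\frac12V(y|0)+\frac12V(y|1)}$, $Z(V)=\sum_y\sqrt{V(y|0)V(y|1)}$, $J(V)=\log\frac{2}{1+Z(V)}$. For B-DMCs $V':\{0,1\}\to\mathcal Y_1$ and $V'':\{0,1\}\to\mathcal Y_2$ define $V'\boxminus V'':\{0,1\}\to\mathcal Y_1\times\mathcal Y_2$ by $(V'\boxminus V'')(y_1,y_2|x_1)=\sum_{x_2\in\{0,1\}}\frac12V'(y_1|x_1\oplus x_2)V''(y_2|x_2)$, and $V'\boxplus V'':\{0,1\}\to\mathcal Y_1\times\mathcal Y_2\times\{0,1\}$ by $(V'\boxplus V'')(y_1,y_2,x_1|x_2)=\frac12V'(y_1|x_1\oplus x_2)V''(y_2|x_2)$. Fix a B-DMC $W$. For every finite string $\mathbf t=(t_1,\dots,t_n)\in\{+,-,\bigstar\}^n$, $n\ge0$, define a B-DMC $W_{\mathbf t}$ recursively: $W_{\emptyset}=W$ for the empty string; for $n\ge1$ let $\mathbf t'=(t_1,\dots,t_{n-1})$ and $\mathbf t''=(t_1,\dots,t_{n-m})$ (the empty string if $n\le m$); then $W_{\mathbf t}=W_{\mathbf t''}\boxplus W_{\mathbf t'}$ if $t_n=+$, $W_{\mathbf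 t}=W_{\mathbf t''}\boxminus W_{\mathbf t'}$ if $t_n=-$, and $W_{\mathbf t}=W_{\mathbf t'}$ if $t_n=\bigstar$. (For $\mathbf s\in\mathcal S_n$, $W_{\mathbf s}$ models the synthesized bit-channel with state vector $\mathbf s$ of the polar code with memory $m$; in the paper's $\bigstar$ case the channel has extra independent outputs, which does not change $I$, $Z$ or $J$.) *)

theory Defs
  imports Complex_Main
begin

datatype sym = Plus | Minus | Star

text \<open>N(n) for n \<ge> 0 (for m \<ge> 1): N(0)=1, N(n+1) = N(n) + N(n+1-m), where
  N(k)=1 for k \<le> 0; since n+1-m = n-(m-1) truncated at 0.\<close>
fun Nseq :: "nat \<Rightarrow> nat \<Rightarrow> nat" where
  "Nseq m 0 = 1"
| "Nseq m (Suc n) = Nseq m n + Nseq m (n - (m - 1))"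

fun svec :: "nat \<Rightarrow> nat \<Rightarrow> nat \<Rightarrow> sym list" where
  "svec m 0 i = []"
| "svec m (Suc n) i =
     (if i \<le> Nseq m (n - (m - 1)) then svec m n i @ [Plus]
      else if i \<le> Nseq m n then svec m n i @ [Star]
      else svec m n (i - Nseq m n) @ [Minus])"

definition Sset :: "nat \<Rightarrow> nat \<Rightarrow> sym list set" where
  "Sset m n = (\<lambda>i. svec m n i) ` {1..Nseq m n}"

datatype 'y outp = Leaf 'y | Node "'y outp" "'y outp" | Node3 "'y outp" "'y outp" bool

text \<open>A B-DMC: finite output alphabet (carrier) and transition probabilities V y x;
  input 0 is False, 1 is True.\<close>
type_synonym 'y chan = "'y outp set \<times> ('y outp \<Rightarrow> bool \<Rightarrow> real)"

definition base_chan :: "('y::finite \<Rightarrow> bool \<Rightarrow> real) \<Rightarrow> 'y chan" where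
  "base_chan W = (range Leaf, \<lambda>y x. case y of Leaf a \<Rightarrow> W a x | _ \<Rightarrow> 0)"

definition bminus :: "'y chan \<Rightarrow> 'y chan \<Rightarrow> 'y chan" where
  "bminus V1 V2 = ((\<lambda>(a,b). Node a b) ` (fst V1 \<times> fst V2),
     \<lambda>y x1. case y of Node a b \<Rightarrow>
        (\<Sum>x2\<in>UNIV. 1/2 * snd V1 a (x1 \<noteq> x2) * snd V2 b x2) | _ \<Rightarrow> 0)"

definition bplus :: "'y chan \<Rightarrow> 'y chan \<Rightarrow> 'y chan" where
  "bplus V1 V2 = ((\<lambda>(a,b,u). Node3 a b u) ` (fst V1 \<times> fst V2 \<times> UNIV),
     \<lambda>y x2. case y of Node3 a b x1 \<Rightarrow> 1/2 * snd V1 a (x1 \<noteq> x2) * snd V2 b x2 | _ \<Rightarrow> 0)"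

definition symI :: "'y chan \<Rightarrow> real" where
  "symI V = (\<Sum>y\<in>fst V. \<Sum>x\<in>UNIV. 1/2 * snd V y x *
      log 2 (snd V y x / (1/2 * snd V y False + 1/2 * snd V y True)))"

text \<open>W_t computed on the reversed string: for t = t' @ [a] with r = rev t',
  rev t'' = drop (m-1) r (t'' = first (length t - m) symbols of t).\<close>
fun chanr :: "nat \<Rightarrow> 'y chan \<Rightarrow> sym list \<Rightarrow> 'y chan" where
  "chanr m W0 [] = W0"
| "chanr m W0 (a # r) = (case a of
      Plus \<Rightarrow> bplus (chanr m W0 (drop (m - 1) r)) (chanr m W0 r)
    | Minus \<Rightarrow> bminus (chanr m W0 (drop (m - 1) r)) (chanr m W0 r)
    | Star \<Rightarrow> chanr m W0 r)"

definition Wt :: "nat \<Rightarrow> ('y::finite \<Rightarrow> bool \<Rightarrow> real) \<Rightarrow> sym list \<Rightarrow> 'y chan" where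
  "Wt m W t = chanr m (base_chan W) (rev t)"

end

theory Submission
  imports Defs
begin

text \<open>
  Let \<open>C\<^sub>n(j)\<close> be the channel with state vector \<open>svec m n j\<close> and \<open>Z\<^sub>n(j)\<close> its Bhattacharyya parameter. The chain
  rule gives \<open>\<Sum>\<^sub>j I(C\<^sub>n(j)) = N(n) I(W)\<close>, and \<open>1 - I \<le> 2 Z / ln 2\<close>, \<open>I \<le> 2 (1 - Z) / ln 2\<close>, so it suffices
  that all but a vanishing fraction of the \<open>Z\<^sub>n(j)\<close> are close to 0 or 1.

  The map \<open>z \<mapsto> (1 - z)\<^sup>2\<close> is a superadditive potential: replacing \<open>u, v\<close> by \<open>u v\<close> and \<open>u + v - u v\<close>
  raises its sum by exactly \<open>2 u v (1 - u) (1 - v)\<close>. Hence the total potential \<open>B\<close> satisfies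
  \<open>B(n) \<ge> B(n-1) + B(n-m) + D(n)\<close> with gain \<open>D(n) \<ge> 0\<close>. Unrolling this recursion, \<open>B \<le> N\<close> and
  \<open>N(k+i) \<le> N(k) N(i)\<close> bound \<open>\<Sum>\<^sub>k D(k) / N(k)\<close>, so \<open>D(n) / N(n) \<longlonglongrightarrow> 0\<close>.

  A small gain alone only says that one of the two combined channels is extreme. But an index
  created by a minus step at time \<open>b\<close> is unchanged until time \<open>b + m - 1\<close> and is then combined with
  itself, so almost all newborn indices are polarized. Afterwards \<open>Z\<close> decreases and \<open>1 - Z\<close> at most
  doubles in each step, so they stay polarized at bounded age; and indices of age at least \<open>l m\<close> make
  up a fraction of at most \<open>2\<^sup>-\<^sup>l\<close>.
\<close>

section \<open>Mutual information and Bhattacharyya parameter\<close>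

definition bdmc :: "'y chan \<Rightarrow> bool" where
  "bdmc V \<longleftrightarrow> finite (fst V) \<and> (\<forall>y\<in>fst V. \<forall>x. 0 \<le> snd V y x) \<and> (\<forall>x. (\<Sum>y\<in>fst V. snd V y x) = 1)"

definition bhat :: "'y chan \<Rightarrow> real" where
  "bhat V = (\<Sum>y\<in>fst V. sqrt (snd V y False * snd V y True))"

section \<open>Estimates for a single output symbol\<close>

definition xlogx :: "real \<Rightarrow> real" where
  "xlogx x = x * log 2 x"

text \<open>The Jensen gap of x log x: the share of one output symbol with likelihoods
  \<open>p\<close>, \<open>q\<close> in the mutual information.\<close>

definition info :: "real \<Rightarrow> real \<Rightarrow> real" where
  "info p q = xlogx p / 2 + xlogx q / 2 - xlogx ((p + q) / 2)"

lemma xlogx_mult: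
  assumes "0 \<le> x" "0 \<le> y"
  shows "xlogx (x * y) = x * xlogx y + y * xlogx x"
proof (cases "x = 0 \<or> y = 0")
  case False
  then show ?thesis
    using assms by (simp add: xlogx_def log_mult algebra_simps)
qed (auto simp: xlogx_def)

lemma log_ratio_info:
  assumes "0 \<le> p" "0 \<le> q"
  shows "1/2 * p * log 2 (p / (1/2 * p + 1/2 * q)) + 1/2 * q * log 2 (q / (1/2 * p + 1/2 * q)) = info p q"
proof -
  have split: "x * log 2 (x / ((p + q) / 2)) = xlogx x - x * log 2 ((p + q) / 2)"
    if "0 \<le> x" "x \<le> p + q" for x
  proof (cases "x = 0")
    case False
    then have "log 2 (x / ((p + q) / 2)) = log 2 x - log 2 ((p + q) / 2)"
      using that by (subst log_divide_pos) auto
    then show ?thesis by (simp add: xlogx_def right_diff_distrib)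
  qed (simp add: xlogx_def)
  have mean: "1/2 * p + 1/2 * q = (p + q) / 2"
    by simp
  have "1/2 * p * log 2 (p / ((p + q) / 2)) + 1/2 * q * log 2 (q / ((p + q) / 2))
      = (p * log 2 (p / ((p + q) / 2)) + q * log 2 (q / ((p + q) / 2))) / 2"
    by (simp add: field_simps)
  also have "\<dots> = info p q"
    using split[of p] split[of q] assms by (simp add: info_def xlogx_def field_simps)
  finally show ?thesis
    unfolding mean .
qed

lemma symI_eq_info:
  assumes "bdmc V"
  shows "symI V = (\<Sum>y\<in>fst V. info (snd V y False) (snd V y True))"
  unfolding symI_def
  by (intro sum.cong refl) (use assms in \<open>simp add: UNIV_bool bdmc_def log_ratio_info[symmetric]\<close>)

lemma info_scale:
  assumes "0 \<le> c" "0 \<le> p" "0 \<le> q"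
  shows "info (c * p) (c * q) = c * info p q"
proof -
  have mean: "(c * p + c * q) / 2 = c * ((p + q) / 2)"
    by (simp add: algebra_simps)
  have "xlogx (c * ((p + q) / 2)) = c * xlogx ((p + q) / 2) + (p + q) / 2 * xlogx c"
    using assms by (intro xlogx_mult) auto
  then show ?thesis
    unfolding info_def mean using assms by (simp add: xlogx_mult field_simps)
qed

text \<open>A pair of outputs gives two symbols of the plus channel and one of the minus channel.
  With 1/2 pulled out, the means subtracted by the former cancel against the likelihoods of the
  latter, and \<open>xlogx_mult\<close> separates the rest.\<close>

lemma info_chain_rule:
  assumes "0 \<le> p0" "0 \<le> p1" "0 \<le> q0" "0 \<le> q1"
  shows "info (1/2 * p0 * q0) (1/2 * p1 * q1) + info (1/2 * p1 * q0) (1/2 * p0 * q1)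
       + info (1/2 * p0 * q0 + 1/2 * p1 * q1) (1/2 * p1 * q0 + 1/2 * p0 * q1)
       = info p0 p1 * ((q0 + q1) / 2) + (p0 + p1) / 2 * info q0 q1"
proof -
  have halves: "info (1/2 * p0 * q0) (1/2 * p1 * q1) = info (p0 * q0) (p1 * q1) / 2"
    "info (1/2 * p1 * q0) (1/2 * p0 * q1) = info (p1 * q0) (p0 * q1) / 2"
    using info_scale[of "1/2" "p0 * q0" "p1 * q1"] info_scale[of "1/2" "p1 * q0" "p0 * q1"] assms
    by (simp_all add: mult.assoc)
  have mean: "(1/2 * p0 * q0 + 1/2 * p1 * q1 + (1/2 * p1 * q0 + 1/2 * p0 * q1)) / 2
      = ((p0 + p1) / 2) * ((q0 + q1) / 2)"
    by (simp add: field_simps)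
  have sums: "1/2 * p0 * q0 + 1/2 * p1 * q1 = (p0 * q0 + p1 * q1) / 2"
    "1/2 * p1 * q0 + 1/2 * p0 * q1 = (p1 * q0 + p0 * q1) / 2"
    by (simp_all add: field_simps)
  have "xlogx (((p0 + p1) / 2) * ((q0 + q1) / 2))
      = (p0 + p1) / 2 * xlogx ((q0 + q1) / 2) + (q0 + q1) / 2 * xlogx ((p0 + p1) / 2)"
    using assms by (intro xlogx_mult) auto
  then show ?thesis
    unfolding halves unfolding info_def mean unfolding sums
    using assms by (simp add: xlogx_mult field_simps)
qed

text \<open>\<open>ln t \<le> t - 1\<close> is used at \<open>t = P / x\<close>; the resulting lower
  bounds \<open>p - P\<close> and \<open>q - P\<close> add up to 0.\<close>

lemma info_nonneg:
  assumes "0 \<le> p" "0 \<le> q"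
  shows "0 \<le> info p q"
proof -
  define P where "P = (p + q) / 2"
  have ge: "x - P \<le> x * ln (x / P)" if "0 \<le> x" "x \<le> 2 * P" for x
  proof (cases "x = 0")
    case False
    then have pos: "0 < x" "0 < P" using that by auto
    have "ln (P / x) \<le> P / x - 1"
      using pos by (intro ln_le_minus_one) auto
    then have "x * ln (P / x) \<le> x * (P / x - 1)"
      using pos by (intro mult_left_mono) auto
    moreover have "ln (P / x) = - ln (x / P)"
      using pos by (simp add: ln_div)
    ultimately show ?thesis using pos by (simp add: algebra_simps)
  qed (use that in auto)
  have "0 \<le> (p * ln (p / P) + q * ln (q / P)) / (2 * ln 2)"
    using ge[of p] ge[of q] assms by (intro divide_nonneg_pos) (auto simp: P_def field_simps)
  also have "\<dots> = info p q"
    unfolding log_ratio_info[OF assms, symmetric] log_def by (simp add: P_def field_simps)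
  finally show ?thesis .
qed

lemma info_le_mean:
  assumes "0 \<le> p" "0 \<le> q"
  shows "info p q \<le> (p + q) / 2"
proof -
  have le: "x * log 2 (x / (1/2 * p + 1/2 * q)) \<le> x" if "0 \<le> x" "x \<le> p + q" for x
  proof (cases "x = 0")
    case False
    then have "log 2 (x / (1/2 * p + 1/2 * q)) \<le> log 2 2"
      using that by (subst log_le_cancel_iff) (auto simp: field_simps)
    then show ?thesis using that mult_left_mono[of _ "1::real" x] by simp
  qed auto
  show ?thesis
    unfolding log_ratio_info[OF assms, symmetric] using le[of p] le[of q] assms by simp
qed

lemma geometric_le_arithmetic:
  assumes "0 \<le> p" "0 \<le> (q::real)"
  shows "sqrt (p * q) \<le> (p + q) / 2"
  using arith_geo_mean_sqrt[OF assms] by simp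

text \<open>\<open>ln t \<le> t - 1\<close> at \<open>t = x / P\<close> leaves a multiple of
  \<open>(P - g) * (P + g) / P\<close>, where \<open>g\<close> is the geometric mean and
  \<open>P + g \<le> 2 * P\<close>.\<close>

lemma info_le_gap:
  assumes "0 \<le> p" "0 \<le> q"
  shows "info p q \<le> 2 / ln 2 * ((p + q) / 2 - sqrt (p * q))"
proof (cases "p + q = 0")
  case True
  then have "p = 0" "q = 0" using assms by auto
  then show ?thesis by (simp add: info_def xlogx_def)
next
  case False
  define P g where "P = (p + q) / 2" and "g = sqrt (p * q)"
  have P: "0 < P" and g: "0 \<le> g" "g \<le> P"
    using False assms geometric_le_arithmetic[OF assms] by (auto simp: P_def g_def)
  have le: "x * ln (x / P) \<le> x * (x / P - 1)" if "0 \<le> x" for x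
    using that P ln_le_minus_one[of "x / P"] by (cases "x = 0") (auto intro!: mult_left_mono)
  have gg: "g * g = p * q"
    using assms by (simp add: g_def)
  have "info p q = (p * ln (p / P) + q * ln (q / P)) / (2 * ln 2)"
    unfolding log_ratio_info[OF assms, symmetric] log_def by (simp add: P_def field_simps)
  also have "\<dots> \<le> (p * (p / P - 1) + q * (q / P - 1)) / (2 * ln 2)"
    using le[of p] le[of q] assms by (intro divide_right_mono) auto
  also have "p * (p / P - 1) + q * (q / P - 1) = 2 * ((P - g) * ((P + g) / P))"
  proof -
    have "p * (p / P - 1) + q * (q / P - 1) = (p * p + q * q - (p + q) * P) / P"
      using P by (simp add: field_simps)
    also have "(p + q) * P = 2 * P * P"
      by (simp add: P_def)
    also have "p * p + q * q - 2 * P * P = 2 * (P * P - g * g)"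
      unfolding gg by (simp add: P_def field_simps)
    finally show ?thesis by (simp add: algebra_simps)
  qed
  also have "2 * ((P - g) * ((P + g) / P)) / (2 * ln 2) \<le> 2 * ((P - g) * 2) / (2 * ln 2)"
    using P g by (intro divide_right_mono mult_left_mono) (auto simp: field_simps)
  finally show ?thesis by (simp add: P_def g_def field_simps)
qed

text \<open>Each likelihood \<open>x\<close> has deficit \<open>x * ln (1 + y / x) / ln 2\<close>.
  With \<open>t = sqrt (y / x)\<close>, the bounds \<open>1 + t * t \<le> (1 + t) * (1 + t)\<close>
  and \<open>ln (1 + t) \<le> t\<close> leave a multiple of
  \<open>x * t = sqrt (x * y)\<close>.\<close>

lemma mean_minus_info_le:
  assumes "0 \<le> p" "0 \<le> q"
  shows "(p + q) / 2 - info p q \<le> 2 / ln 2 * sqrt (p * q)"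
proof -
  have le: "x - x * log 2 (x / ((x + y) / 2)) \<le> 2 / ln 2 * sqrt (x * y)"
    if "0 \<le> x" "0 \<le> y" for x y
  proof (cases "x = 0")
    case False
    with that have x: "0 < x" by simp
    define t where "t = sqrt (y / x)"
    have t: "0 \<le> t" "t * t = y / x" using that by (auto simp: t_def)
    have xt: "x * t = sqrt (x * y)"
    proof -
      have "sqrt (x * y) = sqrt (x * x * (y / x))" using x by simp
      also have "\<dots> = x * t" unfolding real_sqrt_mult t_def using x by simp
      finally show ?thesis by simp
    qed
    have "log 2 (x / ((x + y) / 2)) = log 2 (2 * (x / (x + y)))"
      by (simp add: field_simps)
    also have "\<dots> = 1 + log 2 (x / (x + y))"
      using x that by (subst log_mult) auto
    also have "log 2 (x / (x + y)) = - ln (1 + t * t) / ln 2"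
      using x that unfolding t(2) by (simp add: log_def ln_div field_simps)
    finally have log_eq: "log 2 (x / ((x + y) / 2)) = 1 + - ln (1 + t * t) / ln 2" .
    have "x - x * log 2 (x / ((x + y) / 2)) = x * ln (1 + t * t) / ln 2"
      unfolding log_eq by (simp add: algebra_simps)
    also have "\<dots> \<le> x * (2 * t) / ln 2"
    proof -
      have "ln (1 + t * t) \<le> ln ((1 + t) * (1 + t))"
        using t(1) by (subst ln_le_cancel_iff) (auto simp: algebra_simps add_pos_nonneg)
      also have "\<dots> = 2 * ln (1 + t)"
        using t(1) by (subst ln_mult) auto
      also have "\<dots> \<le> 2 * t"
        using t(1) ln_add_one_self_le_self[of t] by simp
      finally show ?thesis using x by (intro divide_right_mono mult_left_mono) auto
    qed
    also have "x * (2 * t) / ln 2 = 2 / ln 2 * sqrt (x * y)"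
      unfolding xt[symmetric] by simp
    finally show ?thesis .
  qed auto
  have "1/2 * p + 1/2 * q = (p + q) / 2" by simp
  then have "(p + q) / 2 - info p q
      = (p - p * log 2 (p / ((p + q) / 2)) + (q - q * log 2 (q / ((q + p) / 2)))) / 2"
    unfolding log_ratio_info[OF assms, symmetric] by (simp add: field_simps)
  also have "\<dots> \<le> (2 / ln 2 * sqrt (p * q) + 2 / ln 2 * sqrt (q * p)) / 2"
    using le[of p q] le[of q p] assms by (intro divide_right_mono add_mono) auto
  finally show ?thesis by (simp add: mult.commute)
qed

section \<open>Channel bounds by summation over the outputs\<close>

lemma bdmc_sum_mean:
  assumes "bdmc V"
  shows "(\<Sum>y\<in>fst V. (snd V y False + snd V y True) / 2) = 1"
  using assms by (simp add: bdmc_def sum.distrib flip: sum_divide_distrib)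

lemma bdmc_nonneg:
  assumes "bdmc V" "y \<in> fst V"
  shows "0 \<le> snd V y x"
  using assms by (auto simp: bdmc_def)

lemma symI_nonneg: "bdmc V \<Longrightarrow> 0 \<le> symI V"
  unfolding symI_eq_info by (intro sum_nonneg info_nonneg) (auto simp: bdmc_nonneg)

lemma symI_le_1:
  assumes "bdmc V"
  shows "symI V \<le> 1"
proof -
  have "symI V \<le> (\<Sum>y\<in>fst V. (snd V y False + snd V y True) / 2)"
    unfolding symI_eq_info[OF assms] by (intro sum_mono info_le_mean) (auto simp: bdmc_nonneg[OF assms])
  then show ?thesis by (simp add: bdmc_sum_mean[OF assms])
qed

lemma symI_le_bhat:
  assumes "bdmc V"
  shows "symI V \<le> 2 / ln 2 * (1 - bhat V)"
proof -
  have "symI V \<le> (\<Sum>y\<in>fst V. 2 / ln 2 *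
      ((snd V y False + snd V y True) / 2 - sqrt (snd V y False * snd V y True)))"
    unfolding symI_eq_info[OF assms] by (intro sum_mono info_le_gap) (auto simp: bdmc_nonneg[OF assms])
  also have "\<dots> = 2 / ln 2 * (1 - bhat V)"
    unfolding bhat_def sum_distrib_left[symmetric] sum_subtractf bdmc_sum_mean[OF assms] ..
  finally show ?thesis .
qed

lemma one_minus_symI_le_bhat:
  assumes "bdmc V"
  shows "1 - symI V \<le> 2 / ln 2 * bhat V"
proof -
  have "1 - symI V = (\<Sum>y\<in>fst V. (snd V y False + snd V y True) / 2 - info (snd V y False) (snd V y True))"
    unfolding symI_eq_info[OF assms] sum_subtractf bdmc_sum_mean[OF assms] ..
  also have "\<dots> \<le> (\<Sum>y\<in>fst V. 2 / ln 2 * sqrt (snd V y False * snd V y True))"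
    by (intro sum_mono mean_minus_info_le) (auto simp: bdmc_nonneg[OF assms])
  finally show ?thesis unfolding bhat_def sum_distrib_left .
qed

lemma bhat_nonneg: "bdmc V \<Longrightarrow> 0 \<le> bhat V"
  unfolding bhat_def by (intro sum_nonneg) (simp add: bdmc_nonneg)

lemma bhat_le_1:
  assumes "bdmc V"
  shows "bhat V \<le> 1"
proof -
  have "bhat V \<le> (\<Sum>y\<in>fst V. (snd V y False + snd V y True) / 2)"
    unfolding bhat_def by (intro sum_mono geometric_le_arithmetic) (auto simp: bdmc_nonneg[OF assms])
  then show ?thesis by (simp add: bdmc_sum_mean[OF assms])
qed

section \<open>The two channel combinations\<close>

lemma sum_bminus:
  "(\<Sum>y\<in>fst (bminus V1 V2). f y) = (\<Sum>a\<in>fst V1. \<Sum>b\<in>fst V2. f (Node a b))"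
  unfolding bminus_def fst_conv
  by (subst sum.reindex) (auto simp: inj_on_def sum.cartesian_product intro!: sum.cong)

lemma sum_bplus:
  "(\<Sum>y\<in>fst (bplus V1 V2). f y)
     = (\<Sum>a\<in>fst V1. \<Sum>b\<in>fst V2. f (Node3 a b False) + f (Node3 a b True))"
proof -
  have "(\<Sum>y\<in>fst (bplus V1 V2). f y) = (\<Sum>(a, b, u)\<in>fst V1 \<times> fst V2 \<times> UNIV. f (Node3 a b u))"
    unfolding bplus_def fst_conv by (subst sum.reindex) (auto simp: inj_on_def intro!: sum.cong)
  also have "\<dots> = (\<Sum>a\<in>fst V1. \<Sum>b\<in>fst V2. \<Sum>u\<in>UNIV. f (Node3 a b u))"
    by (simp add: sum.cartesian_product)
  finally show ?thesis by (simp add: UNIV_bool)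
qed

lemma snd_bminus:
  "snd (bminus V1 V2) (Node a b) False = 1/2 * snd V1 a False * snd V2 b False + 1/2 * snd V1 a True * snd V2 b True"
  "snd (bminus V1 V2) (Node a b) True = 1/2 * snd V1 a True * snd V2 b False + 1/2 * snd V1 a False * snd V2 b True"
  by (simp_all add: bminus_def UNIV_bool)

lemma snd_bplus:
  "snd (bplus V1 V2) (Node3 a b u) x = 1/2 * snd V1 a (u \<noteq> x) * snd V2 b x"
  by (simp add: bplus_def)

lemma sum_pair_product:
  fixes f g :: "_ \<Rightarrow> real"
  shows "(\<Sum>a\<in>A. \<Sum>b\<in>B. f a * g b) = sum f A * sum g B"
  by (simp add: sum_product)

lemma bdmc_bminus:
  assumes "bdmc V1" "bdmc V2"
  shows "bdmc (bminus V1 V2)"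
  unfolding bdmc_def
proof (intro conjI allI ballI)
  show "finite (fst (bminus V1 V2))"
    using assms by (auto simp: bminus_def bdmc_def)
  show "0 \<le> snd (bminus V1 V2) y x" if "y \<in> fst (bminus V1 V2)" for y x
    using that assms by (auto simp: bminus_def intro!: sum_nonneg mult_nonneg_nonneg bdmc_nonneg)
  show "(\<Sum>y\<in>fst (bminus V1 V2). snd (bminus V1 V2) y x) = 1" for x
    using assms
    by (cases x) (simp_all add: sum_bminus snd_bminus sum.distrib sum_pair_product bdmc_def mult.assoc
        flip: sum_divide_distrib sum_distrib_left)
qed

lemma bdmc_bplus:
  assumes "bdmc V1" "bdmc V2"
  shows "bdmc (bplus V1 V2)"
  unfolding bdmc_def
proof (intro conjI allI ballI)
  show "finite (fst (bplus V1 V2))"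
    using assms by (auto simp: bplus_def bdmc_def)
  show "0 \<le> snd (bplus V1 V2) y x" if "y \<in> fst (bplus V1 V2)" for y x
    using that assms by (auto simp: bplus_def intro!: mult_nonneg_nonneg bdmc_nonneg)
  show "(\<Sum>y\<in>fst (bplus V1 V2). snd (bplus V1 V2) y x) = 1" for x
    using assms
    by (cases x) (simp_all add: sum_bplus snd_bplus sum.distrib sum_pair_product bdmc_def mult.assoc
        flip: sum_divide_distrib sum_distrib_left)
qed

lemma symI_bplus_bminus:
  assumes V1: "bdmc V1" and V2: "bdmc V2"
  shows "symI (bplus V1 V2) + symI (bminus V1 V2) = symI V1 + symI V2"
proof -
  let ?i1 = "\<lambda>a. info (snd V1 a False) (snd V1 a True)"
  let ?i2 = "\<lambda>b. info (snd V2 b False) (snd V2 b True)"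
  let ?m1 = "\<lambda>a. (snd V1 a False + snd V1 a True) / 2"
  let ?m2 = "\<lambda>b. (snd V2 b False + snd V2 b True) / 2"
  have "symI (bplus V1 V2) + symI (bminus V1 V2)
      = (\<Sum>a\<in>fst V1. \<Sum>b\<in>fst V2. ?i1 a * ?m2 b + ?m1 a * ?i2 b)"
    unfolding symI_eq_info[OF bdmc_bplus[OF V1 V2]] symI_eq_info[OF bdmc_bminus[OF V1 V2]]
      sum_bplus sum_bminus sum.distrib[symmetric]
    by (intro sum.cong refl)
      (subst info_chain_rule[symmetric]; simp add: snd_bplus snd_bminus bdmc_nonneg[OF V1] bdmc_nonneg[OF V2])
  also have "\<dots> = sum ?i1 (fst V1) * sum ?m2 (fst V2) + sum ?m1 (fst V1) * sum ?i2 (fst V2)"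
    unfolding sum.distrib sum_pair_product ..
  also have "\<dots> = symI V1 + symI V2"
    unfolding bdmc_sum_mean[OF V1] bdmc_sum_mean[OF V2] symI_eq_info[OF V1] symI_eq_info[OF V2] by simp
  finally show ?thesis .
qed

lemma bhat_bplus: "bhat (bplus V1 V2) = bhat V1 * bhat V2"
proof -
  \<comment> \<open>Swapping \<open>p\<close> and \<open>p'\<close> leaves the value unchanged, so
    the two values of the revealed bit contribute equal halves.\<close>
  have half: "sqrt ((1/2 * p * q) * (1/2 * p' * q')) = sqrt (p * p') * sqrt (q * q') / 2" for p p' q q' :: real
  proof -
    have "(1/2 * p * q) * (1/2 * p' * q') = (p * p') * (q * q') / 4" by simp
    then show ?thesis by (simp add: real_sqrt_mult real_sqrt_divide)
  qed
  show ?thesis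
    unfolding bhat_def sum_bplus snd_bplus sum_pair_product[symmetric] half
    by (intro sum.cong refl) (simp add: mult.commute)
qed

text \<open>With the arithmetic means \<open>P\<close>, \<open>Q\<close>, the square of the right
  side exceeds the product under the root by \<open>2 * (g * h) * ((P - g) * (Q - h))\<close>, which
  is nonnegative by AM-GM.\<close>

lemma sqrt_bminus_le:
  assumes "0 \<le> p0" "0 \<le> p1" "0 \<le> q0" "0 \<le> (q1::real)"
  defines "g \<equiv> sqrt (p0 * p1)" and "h \<equiv> sqrt (q0 * q1)"
  shows "sqrt ((1/2 * p0 * q0 + 1/2 * p1 * q1) * (1/2 * p1 * q0 + 1/2 * p0 * q1))
     \<le> g * ((q0 + q1) / 2) + (p0 + p1) / 2 * h - g * h"
proof (rule real_le_lsqrt)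
  define P Q where "P = (p0 + p1) / 2" and "Q = (q0 + q1) / 2"
  have gh: "0 \<le> g" "0 \<le> h" "g \<le> P" "h \<le> Q" "g * g = p0 * p1" "h * h = q0 * q1"
    using assms geometric_le_arithmetic[of p0 p1] geometric_le_arithmetic[of q0 q1]
    by (auto simp: P_def Q_def)
  have "0 \<le> g * Q + h * (P - g)"
    using gh by (intro add_nonneg_nonneg mult_nonneg_nonneg) auto
  then show "0 \<le> g * ((q0 + q1) / 2) + (p0 + p1) / 2 * h - g * h"
    by (simp add: P_def Q_def algebra_simps)
  have "(1/2 * p0 * q0 + 1/2 * p1 * q1) * (1/2 * p1 * q0 + 1/2 * p0 * q1)
      = (p0 * p1) * Q\<^sup>2 + (q0 * q1) * P\<^sup>2 - (p0 * p1) * (q0 * q1)"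
    by (simp add: P_def Q_def power2_eq_square field_simps)
  also have "\<dots> = (g * Q + P * h - g * h)\<^sup>2 - 2 * (g * h) * ((P - g) * (Q - h))"
    unfolding gh(5,6)[symmetric] by (simp add: power2_eq_square algebra_simps)
  also have "\<dots> \<le> (g * Q + P * h - g * h)\<^sup>2"
    using gh by (simp add: mult_nonneg_nonneg)
  finally show "(1/2 * p0 * q0 + 1/2 * p1 * q1) * (1/2 * p1 * q0 + 1/2 * p0 * q1)
      \<le> (g * ((q0 + q1) / 2) + (p0 + p1) / 2 * h - g * h)\<^sup>2"
    by (simp add: P_def Q_def)
qed

lemma bhat_bminus_le:
  assumes V1: "bdmc V1" and V2: "bdmc V2"
  shows "bhat (bminus V1 V2) \<le> bhat V1 + bhat V2 - bhat V1 * bhat V2"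
proof -
  let ?g1 = "\<lambda>a. sqrt (snd V1 a False * snd V1 a True)"
  let ?g2 = "\<lambda>b. sqrt (snd V2 b False * snd V2 b True)"
  let ?m1 = "\<lambda>a. (snd V1 a False + snd V1 a True) / 2"
  let ?m2 = "\<lambda>b. (snd V2 b False + snd V2 b True) / 2"
  have "bhat (bminus V1 V2) \<le> (\<Sum>a\<in>fst V1. \<Sum>b\<in>fst V2. ?g1 a * ?m2 b + ?m1 a * ?g2 b - ?g1 a * ?g2 b)"
    unfolding bhat_def sum_bminus snd_bminus
    by (intro sum_mono sqrt_bminus_le) (auto simp: bdmc_nonneg[OF V1] bdmc_nonneg[OF V2])
  also have "\<dots> = bhat V1 + bhat V2 - bhat V1 * bhat V2"
    unfolding sum.distrib sum_subtractf sum_pair_product bdmc_sum_mean[OF V1] bdmc_sum_mean[OF V2] bhat_def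
    by simp
  finally show ?thesis .
qed

section \<open>The generation sizes\<close>

lemma Nseq_pos: "0 < Nseq m n"
  by (induction n) auto

lemma Nseq_mono: "k \<le> n \<Longrightarrow> Nseq m k \<le> Nseq m n"
  by (rule lift_Suc_mono_le) auto

lemma Nseq_add_le_pow: "Nseq m (n + i) \<le> 2 ^ i * Nseq m n"
proof (induction i)
  case (Suc i)
  have "Nseq m (n + i - (m - 1)) \<le> Nseq m (n + i)"
    by (rule Nseq_mono) simp
  with Suc show ?case by simp
qed simp

lemma Nseq_submult: "Nseq m (k + i) \<le> Nseq m k * Nseq m i"
proof (induction i rule: less_induct)
  case (less i)
  show ?case
  proof (cases i)
    case (Suc i')
    \<comment> \<open>Truncated subtraction: cutting off at 0 before adding \<open>k\<close> can
      only enlarge the argument.\<close>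
    have "Nseq m (k + i' - (m - 1)) \<le> Nseq m (k + (i' - (m - 1)))"
      by (rule Nseq_mono) simp
    also have "\<dots> \<le> Nseq m k * Nseq m (i' - (m - 1))"
      using less Suc by simp
    finally show ?thesis
      using less[of i'] Suc by (simp add: distrib_left)
  qed simp
qed

text \<open>A block of \<open>m\<close> steps at least doubles the size: its last step adds the size
  at the start of the block to one that is no smaller.\<close>

lemma Nseq_pow_le:
  assumes "1 \<le> m"
  shows "2 ^ l * Nseq m n \<le> Nseq m (n + l * m)"
proof (induction l)
  case (Suc l)
  obtain m' where m': "m = Suc m'"
    using assms by (cases m) auto
  have "2 * Nseq m (n + l * m) \<le> Nseq m (n + l * m + m') + Nseq m (n + l * m + m' - (m - 1))"
    using Nseq_mono[of "n + l * m" "n + l * m + m'" m] by (simp add: m')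
  also have "\<dots> = Nseq m (Suc (n + l * m + m'))"
    by simp
  also have "Suc (n + l * m + m') = n + Suc l * m"
    by (simp add: m')
  finally show ?case using Suc by simp
qed simp

text \<open>A generation consists of plus indices \<open>j\<close>, their minus twins
  \<open>j + Nseq m n\<close>, and starred indices. The truncated \<open>q\<close> stands for time n
  + 1 - m, since every nonpositive time has the single index of time 0.\<close>

lemma sum_generation:
  fixes f :: "nat \<Rightarrow> 'a::comm_monoid_add" and m n :: nat
  defines "q \<equiv> n - (m - 1)"
  shows "(\<Sum>j\<in>{1..Nseq m (Suc n)}. f j)
    = (\<Sum>j\<in>{1..Nseq m q}. f j + f (j + Nseq m n)) + (\<Sum>j\<in>{Nseq m q<..Nseq m n}. f j)"
proof -
  have le: "Nseq m q \<le> Nseq m n"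
    by (rule Nseq_mono) (simp add: q_def)
  have "{1..Nseq m (Suc n)}
      = ({1..Nseq m q} \<union> {Nseq m q<..Nseq m n}) \<union> (\<lambda>j. j + Nseq m n) ` {1..Nseq m q}"
    using le by (auto simp: q_def image_iff intro: bexI[of _ "_ - Nseq m n"])
  moreover have "sum f \<dots> = sum f ({1..Nseq m q} \<union> {Nseq m q<..Nseq m n})
      + sum f ((\<lambda>j. j + Nseq m n) ` {1..Nseq m q})"
    using le by (intro sum.union_disjoint) auto
  moreover have "sum f ({1..Nseq m q} \<union> {Nseq m q<..Nseq m n})
      = sum f {1..Nseq m q} + sum f {Nseq m q<..Nseq m n}"
    by (intro sum.union_disjoint) auto
  moreover have "sum f ((\<lambda>j. j + Nseq m n) ` {1..Nseq m q}) = (\<Sum>j\<in>{1..Nseq m q}. f (j + Nseq m n))"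
    by (subst sum.reindex) (auto simp: inj_on_def)
  ultimately show ?thesis
    by (simp add: sum.distrib add_ac)
qed

lemma sum_to_Nseq_split:
  fixes f :: "nat \<Rightarrow> 'a::comm_monoid_add"
  assumes "k \<le> n"
  shows "(\<Sum>j\<in>{1..Nseq m n}. f j) = (\<Sum>j\<in>{1..Nseq m k}. f j) + (\<Sum>j\<in>{Nseq m k<..Nseq m n}. f j)"
proof -
  have "{1..Nseq m n} = {1..Nseq m k} \<union> {Nseq m k<..Nseq m n}"
    using Nseq_mono[OF assms, of m] by auto
  then show ?thesis
    by (simp only:) (intro sum.union_disjoint, auto)
qed

section \<open>Polarization of the Bhattacharyya parameters\<close>

text \<open>Isolates the properties of the Bhattacharyya parameters on which polarization rests, so
  that channels disappear from the argument; a minus step enters only through an upper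
  bound.\<close>

locale memory_recursion =
  fixes m :: nat and z :: "nat \<Rightarrow> nat \<Rightarrow> real"
  assumes m_pos: "1 \<le> m"
    and z_nonneg: "j \<in> {1..Nseq m n} \<Longrightarrow> 0 \<le> z n j"
    and z_le_1: "j \<in> {1..Nseq m n} \<Longrightarrow> z n j \<le> 1"
    and z_plus: "j \<in> {1..Nseq m (n - (m - 1))} \<Longrightarrow> z (Suc n) j = z (n - (m - 1)) j * z n j"
    and z_minus: "j \<in> {1..Nseq m (n - (m - 1))} \<Longrightarrow>
      z (Suc n) (j + Nseq m n) \<le> z (n - (m - 1)) j + z n j - z (n - (m - 1)) j * z n j"
    and z_star: "j \<in> {Nseq m (n - (m - 1))<..Nseq m n} \<Longrightarrow> z (Suc n) j = z n j"
begin

section \<open>The potential and its summable gain\<close>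

definition potential :: "nat \<Rightarrow> real" where
  "potential n = (\<Sum>j\<in>{1..Nseq m n}. (1 - z n j)\<^sup>2)"

definition gain :: "nat \<Rightarrow> real" where
  "gain n = (\<Sum>j\<in>{1..Nseq m (n - (m - 1))}.
     2 * z (n - (m - 1)) j * z n j * (1 - z (n - (m - 1)) j) * (1 - z n j))"

lemma old_index:
  assumes "j \<in> {1..Nseq m (n - (m - 1))}"
  shows "j \<in> {1..Nseq m n}"
  using assms Nseq_mono[of "n - (m - 1)" n m] by auto

lemma potential_Suc: "potential n + potential (n - (m - 1)) + gain n \<le> potential (Suc n)"
proof -
  let ?q = "n - (m - 1)"
  have step: "(1 - z ?q j)\<^sup>2 + (1 - z n j)\<^sup>2 + 2 * z ?q j * z n j * (1 - z ?q j) * (1 - z n j)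
      \<le> (1 - z (Suc n) j)\<^sup>2 + (1 - z (Suc n) (j + Nseq m n))\<^sup>2"
    if j: "j \<in> {1..Nseq m ?q}" for j
  proof -
    define u v w where "u = z ?q j" and "v = z n j" and "w = z (Suc n) (j + Nseq m n)"
    have w: "w \<le> u + v - u * v"
      using z_minus[OF j] by (simp add: u_def v_def w_def)
    have uv: "u \<le> 1" "v \<le> 1"
      using z_le_1[OF j] z_le_1[OF old_index[OF j]] by (auto simp: u_def v_def)
    \<comment> \<open>The smaller base is nonnegative, so squaring preserves the order, and a
      \<open>w\<close> below its bound only raises the potential.\<close>
    have "0 \<le> (1 - u) * (1 - v)"
      using uv by (intro mult_nonneg_nonneg) auto
    also have "\<dots> = 1 - (u + v - u * v)"
      by (simp add: algebra_simps)
    finally have "(1 - (u + v - u * v))\<^sup>2 \<le> (1 - w)\<^sup>2"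
      using w by (intro power_mono) auto
    moreover have "(1 - u)\<^sup>2 + (1 - v)\<^sup>2 + 2 * u * v * (1 - u) * (1 - v)
        = (1 - u * v)\<^sup>2 + (1 - (u + v - u * v))\<^sup>2"
      by (simp add: power2_eq_square algebra_simps)
    ultimately show ?thesis
      unfolding z_plus[OF j] by (simp add: u_def v_def w_def)
  qed
  have "potential n + potential ?q + gain n
      = (\<Sum>j\<in>{1..Nseq m ?q}. (1 - z ?q j)\<^sup>2 + (1 - z n j)\<^sup>2 + 2 * z ?q j * z n j * (1 - z ?q j) * (1 - z n j))
        + (\<Sum>j\<in>{Nseq m ?q<..Nseq m n}. (1 - z n j)\<^sup>2)"
    unfolding potential_def gain_def
    by (subst sum_to_Nseq_split[of ?q n]) (simp_all add: sum.distrib)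
  also have "\<dots> \<le> (\<Sum>j\<in>{1..Nseq m ?q}. (1 - z (Suc n) j)\<^sup>2 + (1 - z (Suc n) (j + Nseq m n))\<^sup>2)
        + (\<Sum>j\<in>{Nseq m ?q<..Nseq m n}. (1 - z (Suc n) j)\<^sup>2)"
    by (intro add_mono sum_mono step) (auto simp: z_star)
  also have "\<dots> = potential (Suc n)"
    unfolding potential_def by (rule sum_generation[symmetric])
  finally show ?thesis .
qed

lemma potential_le: "potential n \<le> Nseq m n"
proof -
  have "potential n \<le> (\<Sum>j\<in>{1..Nseq m n}. 1)"
    unfolding potential_def
    by (intro sum_mono power_le_one) (use z_nonneg z_le_1 in \<open>auto simp: algebra_simps\<close>)
  then show ?thesis by simp
qed

lemma gain_nonneg: "0 \<le> gain n"
  unfolding gain_def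
  by (intro sum_nonneg mult_nonneg_nonneg)
    (use z_nonneg z_le_1 old_index in \<open>auto simp: algebra_simps\<close>)

text \<open>Unrolls \<open>potential_Suc\<close>. The coefficient of \<open>gain k\<close> obeys the
  recursion of the sizes but starts from zeros before time \<open>k + 1\<close>, which keeps it at 1
  for \<open>m\<close> steps; hence the size sequence delayed by \<open>m - 1\<close>.\<close>

lemma gain_convolution_le:
  "(\<Sum>k<n. gain k * Nseq m (n - Suc k - (m - 1))) \<le> potential n"
proof (induction n rule: less_induct)
  case (less n)
  define F where "F i = real (Nseq m (i - (m - 1)))" for i
  show ?case
  proof (cases n)
    case 0
    then show ?thesis by (simp add: potential_def)
  next
    case (Suc n')
    define q where "q = n' - (m - 1)"
    have F_step: "F (n' - k) = F (n' - Suc k) + (if k < q then F (q - Suc k) else 0)" if "k < n'" for k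
    proof (cases "k < q")
      case True
      then have eq: "n' - k - (m - 1) = Suc (n' - Suc k - (m - 1))" "q - Suc k = n' - Suc k - (m - 1)"
        by (auto simp: q_def)
      show ?thesis
        unfolding F_def eq using True by simp
    next
      case False
      then have "n' - k - (m - 1) = 0" "n' - Suc k - (m - 1) = 0"
        by (auto simp: q_def)
      then show ?thesis using False by (simp add: F_def)
    qed
    have "(\<Sum>k<n. gain k * F (n - Suc k)) = gain n' + (\<Sum>k<n'. gain k * F (n' - k))"
      by (simp add: Suc F_def)
    also have "(\<Sum>k<n'. gain k * F (n' - k))
        = (\<Sum>k<n'. gain k * F (n' - Suc k)) + (\<Sum>k<n'. if k < q then gain k * F (q - Suc k) else 0)"
      unfolding sum.distrib[symmetric]
      by (intro sum.cong refl) (simp add: F_step distrib_left)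
    also have "(\<Sum>k<n'. if k < q then gain k * F (q - Suc k) else 0) = (\<Sum>k<q. gain k * F (q - Suc k))"
      by (intro sum.mono_neutral_cong_right) (auto simp: q_def)
    finally have "(\<Sum>k<n. gain k * F (n - Suc k))
        = gain n' + ((\<Sum>k<n'. gain k * F (n' - Suc k)) + (\<Sum>k<q. gain k * F (q - Suc k)))" .
    also have "\<dots> \<le> gain n' + (potential n' + potential q)"
      using less[of n'] less[of q] Suc by (intro add_left_mono add_mono) (auto simp: F_def q_def)
    also have "\<dots> \<le> potential n"
      using potential_Suc[of n'] by (simp add: q_def Suc)
    finally show ?thesis by (simp add: F_def)
  qed
qed

text \<open>The series converges: \<open>Nseq m n / Nseq m k\<close> is at most 2^m times the
  coefficient of \<open>gain k\<close> in \<open>gain_convolution_le\<close>, so a partial sum is at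
  most \<open>2 ^ m * potential n / Nseq m n\<close>.\<close>

lemma gain_tendsto_0: "(\<lambda>n. gain n / Nseq m n) \<longlonglongrightarrow> 0"
proof (rule summable_LIMSEQ_zero, rule summableI_nonneg_bounded)
  show "0 \<le> gain n / Nseq m n" for n
    using gain_nonneg by simp
  show "(\<Sum>k<n. gain k / Nseq m k) \<le> 2 ^ m" for n
  proof -
    \<comment> \<open>One factor 2 pays for the step from \<open>k\<close> to \<open>Suc k\<close>,
      the factor \<open>2 ^ (m - 1)\<close> for the delay in the coefficient.\<close>
    have ratio: "Nseq m n / Nseq m k \<le> 2 ^ m * real (Nseq m (n - Suc k - (m - 1)))" if "k < n" for k
    proof -
      define i where "i = n - Suc k"
      have n: "n = Suc k + i"
        using that by (simp add: i_def)
      have "Nseq m n \<le> Nseq m (Suc k) * Nseq m i"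
        unfolding n by (rule Nseq_submult)
      also have "\<dots> \<le> (2 * Nseq m k) * (2 ^ (m - 1) * Nseq m (i - (m - 1)))"
      proof (rule mult_le_mono)
        show "Nseq m (Suc k) \<le> 2 * Nseq m k"
          using Nseq_add_le_pow[of m k 1] by simp
        have "Nseq m i \<le> Nseq m (i - (m - 1) + (m - 1))"
          by (rule Nseq_mono) simp
        also have "\<dots> \<le> 2 ^ (m - 1) * Nseq m (i - (m - 1))"
          by (rule Nseq_add_le_pow)
        finally show "Nseq m i \<le> 2 ^ (m - 1) * Nseq m (i - (m - 1))" .
      qed
      also have "\<dots> = 2 ^ m * Nseq m (i - (m - 1)) * Nseq m k"
        using m_pos by (cases m) auto
      finally have "real (Nseq m n) \<le> 2 ^ m * real (Nseq m (i - (m - 1))) * real (Nseq m k)"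
        using of_nat_mono by fastforce
      then show ?thesis
        using Nseq_pos[of m k] by (simp add: i_def pos_divide_le_eq)
    qed
    have "Nseq m n * (\<Sum>k<n. gain k / Nseq m k) = (\<Sum>k<n. gain k * (Nseq m n / Nseq m k))"
      by (simp add: sum_distrib_left mult.commute)
    also have "\<dots> \<le> (\<Sum>k<n. gain k * (2 ^ m * real (Nseq m (n - Suc k - (m - 1)))))"
      by (intro sum_mono mult_left_mono ratio gain_nonneg) auto
    also have "\<dots> = 2 ^ m * (\<Sum>k<n. gain k * Nseq m (n - Suc k - (m - 1)))"
      by (simp add: sum_distrib_left mult_ac)
    also have "\<dots> \<le> 2 ^ m * real (Nseq m n)"
      using gain_convolution_le[of n] potential_le[of n] by (intro mult_left_mono) auto
    finally show ?thesis
      using Nseq_pos[of m n] by (simp add: mult.commute)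
  qed
qed

text \<open>Indices in \<open>{Nseq m c<..Nseq m (Suc c)}\<close> are born at time \<open>Suc c\<close>. Their value stays frozen
  for \<open>m - 1\<close> steps, after which a channel is combined with an identical copy of itself; so the
  gain at time \<open>c + m\<close> controls the newborn indices that are not yet polarized.\<close>

definition unpolarized_born :: "real \<Rightarrow> nat \<Rightarrow> nat set" where
  "unpolarized_born \<eta> c = {j \<in> {Nseq m c<..Nseq m (Suc c)}. \<eta> \<le> z (Suc c) j \<and> z (Suc c) j \<le> 1 - \<eta>}"

lemma z_frozen:
  assumes "j \<in> {Nseq m c<..Nseq m (Suc c)}" "i \<le> m - 1"
  shows "z (Suc c + i) j = z (Suc c) j"
  using assms(2)
proof (induction i)
  case (Suc i)
  \<comment> \<open>The earlier generation taking part in this step is still \<open>c\<close> or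
    older, so \<open>j\<close> has no partner in it and only a star is appended.\<close>
  have "Nseq m (Suc c + i - (m - 1)) \<le> Nseq m c"
    using Suc.prems by (intro Nseq_mono) auto
  moreover have "Nseq m (Suc c) \<le> Nseq m (Suc c + i)"
    by (rule Nseq_mono) simp
  ultimately have "z (Suc (Suc c + i)) j = z (Suc c + i) j"
    using assms(1) by (intro z_star) auto
  with Suc show ?case by simp
qed simp

text \<open>By \<open>z_frozen\<close> both values combined at time \<open>c + m\<close> are the
  birth value, so each of the four factors of the gain term is at least \<eta>.\<close>

lemma unpolarized_born_le_gain:
  assumes "0 < \<eta>"
  shows "2 * \<eta> ^ 4 * card (unpolarized_born \<eta> c) \<le> gain (c + m)"
proof -
  define U where "U = unpolarized_born \<eta> c"
  have q: "c + m - (m - 1) = Suc c"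
    using m_pos by auto
  have U: "U \<subseteq> {1..Nseq m (Suc c)}"
    by (auto simp: U_def unpolarized_born_def)
  have frozen: "z (c + m) j = z (Suc c) j" if "j \<in> U" for j
    using z_frozen[of j c "m - 1"] that m_pos by (simp add: U_def unpolarized_born_def)
  have "2 * \<eta> ^ 4 * card U = (\<Sum>j\<in>U. 2 * \<eta> * \<eta> * \<eta> * \<eta>)"
    by (simp add: power4_eq_xxxx)
  also have "\<dots> \<le> (\<Sum>j\<in>U. 2 * z (Suc c) j * z (c + m) j * (1 - z (Suc c) j) * (1 - z (c + m) j))"
    using assms
    by (intro sum_mono mult_mono)
      (auto simp: frozen intro!: mult_nonneg_nonneg, auto simp: U_def unpolarized_born_def)
  also have "\<dots> \<le> gain (c + m)"
    unfolding gain_def q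
  proof (rule sum_mono2)
    show "0 \<le> 2 * z (Suc c) j * z (c + m) j * (1 - z (Suc c) j) * (1 - z (c + m) j)"
      if "j \<in> {1..Nseq m (Suc c)} - U" for j
    proof -
      have "j \<in> {1..Nseq m (Suc c)}" "j \<in> {1..Nseq m (c + m)}"
        using that old_index[of j "c + m"] unfolding q by blast+
      then show ?thesis
        using z_nonneg z_le_1 by (intro mult_nonneg_nonneg) (auto simp: algebra_simps)
    qed
  qed (use U in auto)
  finally show ?thesis by (simp add: U_def)
qed

lemma unpolarized_born_tendsto_0:
  assumes "0 < \<eta>"
  shows "(\<lambda>c. card (unpolarized_born \<eta> c) / Nseq m (Suc c)) \<longlonglongrightarrow> 0"
proof (rule tendsto_sandwich[OF _ _ tendsto_const])
  \<comment> \<open>\<open>2 * \<eta> ^ 4\<close> comes from the gain bound;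
    \<open>2 ^ (m - 1)\<close> converts the normalization at time \<open>Suc c\<close> into the one
    at time \<open>c + m\<close>.\<close>
  let ?K = "2 ^ (m - 1) / (2 * \<eta> ^ 4)"
  have "(\<lambda>c. ?K * (gain (c + m) / Nseq m (c + m))) \<longlonglongrightarrow> ?K * 0"
    by (intro tendsto_mult_left LIMSEQ_ignore_initial_segment gain_tendsto_0)
  then show "(\<lambda>c. ?K * (gain (c + m) / Nseq m (c + m))) \<longlonglongrightarrow> 0"
    by simp
  show "\<forall>\<^sub>F c in sequentially. card (unpolarized_born \<eta> c) / Nseq m (Suc c)
      \<le> ?K * (gain (c + m) / Nseq m (c + m))"
  proof (intro always_eventually allI)
    fix c
    have "Nseq m (c + m) \<le> 2 ^ (m - 1) * Nseq m (Suc c)"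
      using Nseq_add_le_pow[of m "Suc c" "m - 1"] m_pos by simp
    then have N: "real (Nseq m (c + m)) \<le> 2 ^ (m - 1) * real (Nseq m (Suc c))"
      using of_nat_mono by fastforce
    have "card (unpolarized_born \<eta> c) \<le> gain (c + m) / (2 * \<eta> ^ 4)"
      using unpolarized_born_le_gain[OF assms, of c] assms by (simp add: pos_le_divide_eq mult.commute)
    then have "card (unpolarized_born \<eta> c) / Nseq m (Suc c)
        \<le> gain (c + m) / (2 * \<eta> ^ 4) * (1 / Nseq m (Suc c))"
      unfolding times_divide_eq_right mult_1_right by (intro divide_right_mono) auto
    also have "1 / real (Nseq m (Suc c)) \<le> 2 ^ (m - 1) / Nseq m (c + m)"
      using N Nseq_pos[of m "Suc c"] Nseq_pos[of m "c + m"] by (simp add: field_simps del: Nseq.simps)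
    then have "gain (c + m) / (2 * \<eta> ^ 4) * (1 / Nseq m (Suc c))
        \<le> gain (c + m) / (2 * \<eta> ^ 4) * (2 ^ (m - 1) / Nseq m (c + m))"
      using gain_nonneg assms by (intro mult_left_mono) auto
    finally show "card (unpolarized_born \<eta> c) / Nseq m (Suc c)
        \<le> ?K * (gain (c + m) / Nseq m (c + m))"
      by (simp add: mult_ac)
  qed
qed auto

text \<open>After its birth an index undergoes only plus and star steps, since a minus step creates
  a new index. Both factors of a plus step are states of the same index, so
  \<open>1 - u * v \<le> (1 - u) + (1 - v)\<close> at most doubles the bound; \<open>u\<close> is an
  older state, hence strong induction.\<close>

lemma z_ageing:
  assumes "j \<in> {Nseq m c<..Nseq m (Suc c)}"
  shows "z (Suc c + i) j \<le> z (Suc c) j \<and> 1 - z (Suc c + i) j \<le> 2 ^ i * (1 - z (Suc c) j)"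
proof (induction i rule: less_induct)
  case (less i)
  have alive: "j \<in> {1..Nseq m (Suc c + i)}" for i
    using assms Nseq_mono[of "Suc c" "Suc c + i" m] by auto
  show ?case
  proof (cases i)
    case (Suc i')
    define n where "n = Suc c + i'"
    have IH: "z n j \<le> z (Suc c) j" "1 - z n j \<le> 2 ^ i' * (1 - z (Suc c) j)"
      using less[of i'] by (auto simp: Suc n_def)
    have gap: "0 \<le> 1 - z (Suc c) j"
      using z_le_1 alive[of 0] by simp
    show ?thesis
    proof (cases "j \<le> Nseq m (n - (m - 1))")
      case True
      \<comment> \<open>Being present in the earlier generation, \<open>j\<close> was born no later,
        so \<open>u\<close> is its state at age \<open>k\<close>.\<close>
      then have "c < n - (m - 1)"
        using assms Nseq_mono[of "n - (m - 1)" c m] by (auto simp: not_less[symmetric] simp del: not_less)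
      then obtain k where k: "n - (m - 1) = Suc c + k" "k \<le> i'"
        by (metis Suc_leI add_le_cancel_left diff_le_self le_Suc_ex n_def)
      define u v where "u = z (Suc c + k) j" and "v = z n j"
      have zuv: "z (Suc n) j = u * v"
        using z_plus[of j n] True alive[of 0] unfolding u_def v_def k(1)[symmetric] by simp
      have uv: "0 \<le> u" "u \<le> 1" "0 \<le> v" "v \<le> 1"
        using z_nonneg z_le_1 alive by (auto simp: u_def v_def n_def)
      have "u * v \<le> v"
        using uv by (simp add: mult_left_le_one_le)
      moreover have "1 - u * v \<le> 2 * 2 ^ i' * (1 - z (Suc c) j)"
      proof -
        have "0 \<le> (1 - u) * (1 - v)"
          using uv by (intro mult_nonneg_nonneg) auto
        then have "1 - u * v \<le> (1 - u) + (1 - v)"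
          by (simp add: algebra_simps)
        moreover have "1 - u \<le> 2 ^ k * (1 - z (Suc c) j)"
          using less[of k] k Suc by (simp add: u_def)
        moreover have "2 ^ k * (1 - z (Suc c) j) \<le> 2 ^ i' * (1 - z (Suc c) j)"
          using k gap by (intro mult_right_mono power_increasing) auto
        ultimately show ?thesis using IH by (simp add: v_def)
      qed
      ultimately show ?thesis
        using IH zuv by (simp add: v_def n_def Suc)
    next
      case False
      then have "z (Suc n) j = z n j"
        using alive[of i'] by (intro z_star) (auto simp: n_def)
      moreover have "2 ^ i' * (1 - z (Suc c) j) \<le> 2 ^ i * (1 - z (Suc c) j)"
        using gap Suc by (intro mult_right_mono power_increasing) auto
      ultimately show ?thesis
        using IH by (simp add: n_def Suc)
    qed
  qed simp
qed

text \<open>An index in the middle range is either at least \<open>A\<close> steps old or a recent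
  birth. In the latter case \<open>z_ageing\<close> read backwards puts its birth value between
  \<epsilon> / 2^A and 1 - \<epsilon> / 2^A.\<close>

lemma unpolarized_subset:
  assumes "0 < \<epsilon>" "A \<le> n"
  shows "{j \<in> {1..Nseq m n}. \<epsilon> \<le> z n j \<and> z n j \<le> 1 - \<epsilon>}
    \<subseteq> {1..Nseq m (n - A)} \<union> (\<Union>a<A. unpolarized_born (\<epsilon> / 2 ^ A) (n - Suc a))"
proof
  fix j assume j: "j \<in> {j \<in> {1..Nseq m n}. \<epsilon> \<le> z n j \<and> z n j \<le> 1 - \<epsilon>}"
  show "j \<in> {1..Nseq m (n - A)} \<union> (\<Union>a<A. unpolarized_born (\<epsilon> / 2 ^ A) (n - Suc a))"
  proof (cases "j \<le> Nseq m (n - A)")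
    case False
    \<comment> \<open>\<open>n - a'\<close> is the last generation without \<open>j\<close>;
      \<open>a'\<close> is positive because \<open>j\<close> exists at time \<open>n\<close>, so
      \<open>j\<close> is born at time \<open>n - a\<close>.\<close>
    define a' where "a' = (LEAST a. Nseq m (n - a) < j)"
    have a': "Nseq m (n - a') < j" "a' \<le> A"
      using False LeastI[of "\<lambda>a. Nseq m (n - a) < j" A] Least_le[of "\<lambda>a. Nseq m (n - a) < j" A]
      by (simp_all add: a'_def)
    then obtain a where a: "a' = Suc a"
      using j by (cases a') auto
    have "\<not> Nseq m (n - a) < j"
      using not_less_Least[of a "\<lambda>a. Nseq m (n - a) < j"] by (simp add: a'_def[symmetric] a)
    moreover have n: "Suc (n - Suc a) = n - a"
      using assms a' a by simp
    ultimately have born: "j \<in> {Nseq m (n - Suc a)<..Nseq m (Suc (n - Suc a))}"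
      using a' a by (simp only: n) auto
    let ?z = "z (Suc (n - Suc a)) j"
    have "Suc (n - Suc a) + a = n"
      using assms a' a by simp
    then have age: "z n j \<le> ?z" "1 - z n j \<le> 2 ^ a * (1 - ?z)"
      using z_ageing[OF born, of a] by auto
    have "0 \<le> 1 - ?z"
      using born by (subst diff_ge_0_iff_ge, intro z_le_1) auto
    then have "2 ^ a * (1 - ?z) \<le> 2 ^ A * (1 - ?z)"
      using a a' by (intro mult_right_mono power_increasing) auto
    then have "\<epsilon> \<le> 2 ^ A * (1 - ?z)"
      using age j by simp
    then have "\<epsilon> / 2 ^ A \<le> 1 - ?z"
      by (simp add: pos_divide_le_eq mult.commute)
    moreover have "\<epsilon> / 2 ^ A \<le> \<epsilon>"
      using assms by (simp add: pos_divide_le_eq)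
    ultimately have "j \<in> unpolarized_born (\<epsilon> / 2 ^ A) (n - Suc a)"
      using born age j by (auto simp: unpolarized_born_def simp del: Nseq.simps)
    then show ?thesis using a a' by auto
  qed (use j in auto)
qed

lemma unpolarized_tendsto_0:
  assumes "0 < \<epsilon>"
  shows "(\<lambda>n. card {j \<in> {1..Nseq m n}. \<epsilon> \<le> z n j \<and> z n j \<le> 1 - \<epsilon>} / Nseq m n) \<longlonglongrightarrow> 0"
    (is "(\<lambda>n. card (?U n) / _) \<longlonglongrightarrow> 0")
proof (rule LIMSEQ_I)
  fix e :: real assume e: "0 < e"
  \<comment> \<open>\<open>A\<close> is fixed before \<open>n\<close> grows: \<open>l\<close>
    doublings of the size make the old indices rarer than \<open>e / 2\<close>, and the
    \<open>A\<close> remaining birth cohorts give a finite sum of null sequences.\<close>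
  obtain l where l: "(1 / 2) ^ l < e / 2"
    using real_arch_pow_inv[of "e / 2" "1 / 2"] e by auto
  define A where "A = l * m"
  let ?u = "\<lambda>c. card (unpolarized_born (\<epsilon> / 2 ^ A) c) / real (Nseq m (Suc c))"
  have "(\<lambda>n. \<Sum>a<A. ?u (n - Suc a)) \<longlonglongrightarrow> (\<Sum>a<A. 0)"
    by (intro tendsto_sum filterlim_compose[OF unpolarized_born_tendsto_0] filterlim_minus_const_nat_at_top)
      (use assms in auto)
  then have "\<forall>\<^sub>F n in sequentially. (\<Sum>a<A. ?u (n - Suc a)) < e / 2"
    by (rule order_tendstoD) (use e in auto)
  then obtain n0 where n0: "\<And>n. n0 \<le> n \<Longrightarrow> (\<Sum>a<A. ?u (n - Suc a)) < e / 2"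
    by (auto simp: eventually_sequentially)
  show "\<exists>n0. \<forall>n\<ge>n0. norm (card (?U n) / Nseq m n - 0) < e"
  proof (intro exI allI impI)
    fix n assume n: "max n0 A \<le> n"
    have "card (?U n) \<le> card ({1..Nseq m (n - A)} \<union> (\<Union>a<A. unpolarized_born (\<epsilon> / 2 ^ A) (n - Suc a)))"
      using n assms by (intro card_mono unpolarized_subset) (auto simp: unpolarized_born_def)
    also have "\<dots> \<le> card {1..Nseq m (n - A)} + card (\<Union>a<A. unpolarized_born (\<epsilon> / 2 ^ A) (n - Suc a))"
      by (rule card_Un_le)
    also have "\<dots> \<le> Nseq m (n - A) + (\<Sum>a<A. card (unpolarized_born (\<epsilon> / 2 ^ A) (n - Suc a)))"
      using card_UN_le[of "{..<A}"] by simp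
    finally have "real (card (?U n)) \<le> real \<dots>"
      by (rule of_nat_mono)
    then have "card (?U n) / Nseq m n
        \<le> (Nseq m (n - A) + (\<Sum>a<A. real (card (unpolarized_born (\<epsilon> / 2 ^ A) (n - Suc a))))) / Nseq m n"
      by (intro divide_right_mono) auto
    also have "\<dots> = Nseq m (n - A) / Nseq m n
        + (\<Sum>a<A. card (unpolarized_born (\<epsilon> / 2 ^ A) (n - Suc a)) / Nseq m n)"
      by (simp add: add_divide_distrib sum_divide_distrib)
    also have "\<dots> < e / 2 + e / 2"
    proof (rule add_strict_mono)
      have "2 ^ l * Nseq m (n - A) \<le> Nseq m n"
        using Nseq_pow_le[OF m_pos, of l "n - A"] n by (simp add: A_def)
      then have "real (2 ^ l * Nseq m (n - A)) \<le> real (Nseq m n)"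
        by (rule of_nat_mono)
      then have "Nseq m (n - A) / Nseq m n \<le> (1 / 2) ^ l"
        using Nseq_pos[of m n] by (simp add: field_simps power_one_over)
      then show "Nseq m (n - A) / Nseq m n < e / 2"
        using l by (rule le_less_trans)
      have "(\<Sum>a<A. card (unpolarized_born (\<epsilon> / 2 ^ A) (n - Suc a)) / Nseq m n) \<le> (\<Sum>a<A. ?u (n - Suc a))"
        by (intro sum_mono divide_left_mono of_nat_mono Nseq_mono)
          (use n Nseq_pos in \<open>auto simp del: Nseq.simps\<close>)
      also have "\<dots> < e / 2"
        using n0 n by simp
      finally show "(\<Sum>a<A. card (unpolarized_born (\<epsilon> / 2 ^ A) (n - Suc a)) / Nseq m n) < e / 2" .
    qed
    finally show "norm (card (?U n) / Nseq m n - 0) < e"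
      by simp
  qed
qed

end

section \<open>From polarization to the limiting fractions\<close>

text \<open>Outside the middle range, \<open>x\<close> is within \<open>e\<close> of the indicator
  of \<open>x > 1 - \<delta>\<close>, so the counted fraction is close to the mean
  \<open>c\<close>.\<close>

lemma polarized_fraction_tendsto:
  fixes x :: "nat \<Rightarrow> nat \<Rightarrow> real" and N :: "nat \<Rightarrow> nat" and c \<delta> :: real
  assumes N: "\<And>n. 0 < N n"
    and range: "\<And>n j. j \<in> {1..N n} \<Longrightarrow> 0 \<le> x n j \<and> x n j \<le> 1"
    and mean: "\<And>n. (\<Sum>j\<in>{1..N n}. x n j) = N n * c"
    and middle: "\<And>e. 0 < e \<Longrightarrow> (\<lambda>n. card {j \<in> {1..N n}. e \<le> x n j \<and> x n j \<le> 1 - e} / N n) \<longlonglongrightarrow> 0"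
    and \<delta>: "0 < \<delta>" "\<delta> < 1"
  shows "(\<lambda>n. card {j \<in> {1..N n}. 1 - \<delta> < x n j} / N n) \<longlonglongrightarrow> c"
proof (rule LIMSEQ_I)
  fix r :: real assume r: "0 < r"
  \<comment> \<open>\<open>r / 2\<close> leaves room for the middle fraction; the other two bounds
    put the threshold \<open>1 - \<delta>\<close> strictly between \<open>e\<close> and
    \<open>1 - e\<close>.\<close>
  define e where "e = Min {r / 2, \<delta> / 2, (1 - \<delta>) / 2}"
  have e: "0 < e" "e \<le> r / 2" "e < \<delta>" "e < 1 - \<delta>"
    using r \<delta> by (auto simp: e_def min_def)
  let ?M = "\<lambda>n. {j \<in> {1..N n}. e \<le> x n j \<and> x n j \<le> 1 - e}"
  let ?H = "\<lambda>n. {j \<in> {1..N n}. 1 - \<delta> < x n j}"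
  obtain n0 where n0: "\<And>n. n0 \<le> n \<Longrightarrow> card (?M n) / N n < r / 2"
    using LIMSEQ_D[OF middle[OF e(1)], of "r / 2"] r by auto
  have card_of_bool: "real (card {j \<in> {1..N n}. P j}) = (\<Sum>j\<in>{1..N n}. of_bool (P j))" for P n
    by (simp add: Int_def)
  have dist: "\<bar>real (card (?H n)) - N n * c\<bar> \<le> N n * e + card (?M n)" for n
  proof -
    have "\<bar>real (card (?H n)) - N n * c\<bar> = \<bar>\<Sum>j\<in>{1..N n}. of_bool (1 - \<delta> < x n j) - x n j\<bar>"
      unfolding card_of_bool mean[symmetric] sum_subtractf ..
    also have "\<dots> \<le> (\<Sum>j\<in>{1..N n}. \<bar>of_bool (1 - \<delta> < x n j) - x n j\<bar>)"
      by (rule sum_abs)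
    also have "\<dots> \<le> (\<Sum>j\<in>{1..N n}. e + of_bool (e \<le> x n j \<and> x n j \<le> 1 - e))"
    proof (rule sum_mono)
      fix j assume "j \<in> {1..N n}"
      then show "\<bar>of_bool (1 - \<delta> < x n j) - x n j\<bar> \<le> e + of_bool (e \<le> x n j \<and> x n j \<le> 1 - e)"
        using range[of j n] e by (auto simp: of_bool_def)
    qed
    also have "\<dots> = N n * e + card (?M n)"
      unfolding sum.distrib card_of_bool by simp
    finally show ?thesis .
  qed
  show "\<exists>n0. \<forall>n\<ge>n0. norm (card (?H n) / N n - c) < r"
  proof (intro exI allI impI)
    fix n assume n: "n0 \<le> n"
    have "norm (card (?H n) / N n - c) = \<bar>(real (card (?H n)) - N n * c) / N n\<bar>"
      using N[of n] by (simp add: diff_divide_distrib)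
    also have "\<dots> = \<bar>real (card (?H n)) - N n * c\<bar> / N n"
      by (simp add: abs_divide)
    also have "\<dots> \<le> (N n * e + card (?M n)) / N n"
      by (intro divide_right_mono dist) auto
    also have "\<dots> = e + card (?M n) / N n"
      using N[of n] by (simp add: add_divide_distrib)
    also have "\<dots> < r / 2 + r / 2"
      using e n0[OF n] by (intro add_le_less_mono) auto
    finally show "norm (card (?H n) / N n - c) < r"
      by simp
  qed
qed

section \<open>The synthesized channels\<close>

lemma length_svec [simp]: "length (svec m n i) = n"
  by (induction n arbitrary: i) auto

text \<open>An index keeps its number, since only the minus branch renumbers. This matches the
  prefix used by the channel recursion with an earlier generation.\<close>

lemma take_svec:
  assumes "k \<le> n" "j \<le> Nseq m k"
  shows "take k (svec m n j) = svec m k j"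
  using assms(1)
proof (induction n rule: dec_induct)
  case (step n)
  moreover have "j \<le> Nseq m n"
    using assms(2) Nseq_mono[OF step(1), of m] by simp
  ultimately show ?case by simp
qed simp

text \<open>The last symbol is minus exactly for numbers above \<open>Nseq m n\<close>, so it
  reveals the shift. Thus \<open>Sset\<close> can be counted by indices.\<close>

lemma inj_on_svec: "inj_on (svec m n) {1..Nseq m n}"
proof (induction n)
  case (Suc n)
  show ?case
  proof (rule inj_onI)
    fix i j assume ij: "i \<in> {1..Nseq m (Suc n)}" "j \<in> {1..Nseq m (Suc n)}"
      and eq: "svec m (Suc n) i = svec m (Suc n) j"
    have le: "Nseq m (n - (m - 1)) \<le> Nseq m n"
      by (rule Nseq_mono) simp
    show "i = j"
    proof (cases "i \<le> Nseq m n")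
      case True
      with eq le have "j \<le> Nseq m n" "svec m n i = svec m n j"
        by (auto split: if_splits)
      with True show ?thesis
        using inj_onD[OF Suc] ij by simp
    next
      case False
      with eq le have "\<not> j \<le> Nseq m n" "svec m n (i - Nseq m n) = svec m n (j - Nseq m n)"
        by (auto split: if_splits)
      moreover from this False ij le have "i - Nseq m n = j - Nseq m n"
        by (intro inj_onD[OF Suc]) auto
      ultimately show ?thesis using False by simp
    qed
  qed
qed (auto simp: inj_on_def)

lemma card_Sset_Collect: "card {s \<in> Sset m n. P s} = card {j \<in> {1..Nseq m n}. P (svec m n j)}"
proof -
  have "{s \<in> Sset m n. P s} = svec m n ` {j \<in> {1..Nseq m n}. P (svec m n j)}"
    by (auto simp: Sset_def)
  then show ?thesis
    by (simp only:) (intro card_image inj_on_subset[OF inj_on_svec], auto)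
qed

section \<open>The channel family as an instance of the recursion\<close>

context
  fixes m :: nat and W :: "'y::finite \<Rightarrow> bool \<Rightarrow> real"
begin

definition synth :: "nat \<Rightarrow> nat \<Rightarrow> 'y chan" where
  "synth n j = Wt m W (svec m n j)"

lemma Wt_snoc:
  "Wt m W (t @ [a]) = (case a of
      Plus \<Rightarrow> bplus (Wt m W (take (length t - (m - 1)) t)) (Wt m W t)
    | Minus \<Rightarrow> bminus (Wt m W (take (length t - (m - 1)) t)) (Wt m W t)
    | Star \<Rightarrow> Wt m W t)"
  by (cases a) (simp_all add: Wt_def drop_rev)

lemma synth_Suc:
  assumes "j \<in> {1..Nseq m (n - (m - 1))}"
  shows "synth (Suc n) j = bplus (synth (n - (m - 1)) j) (synth n j)"
    and "synth (Suc n) (j + Nseq m n) = bminus (synth (n - (m - 1)) j) (synth n j)"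
proof -
  have "Nseq m (n - (m - 1)) \<le> Nseq m n"
    by (rule Nseq_mono) simp
  then have "svec m (Suc n) j = svec m n j @ [Plus]"
    "svec m (Suc n) (j + Nseq m n) = svec m n j @ [Minus]"
    using assms by auto
  moreover have "take (n - (m - 1)) (svec m n j) = svec m (n - (m - 1)) j"
    using assms by (intro take_svec) auto
  ultimately show "synth (Suc n) j = bplus (synth (n - (m - 1)) j) (synth n j)"
    and "synth (Suc n) (j + Nseq m n) = bminus (synth (n - (m - 1)) j) (synth n j)"
    by (simp_all only: synth_def Wt_snoc length_svec sym.case)
qed

lemma synth_Suc_star:
  assumes "j \<in> {Nseq m (n - (m - 1))<..Nseq m n}"
  shows "synth (Suc n) j = synth n j"
  using assms by (simp add: synth_def Wt_snoc)

context
  assumes W_nonneg: "\<And>y x. 0 \<le> W y x" and W_sum: "\<And>x. (\<Sum>y\<in>UNIV. W y x) = 1"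
begin

lemma bdmc_base_chan: "bdmc (base_chan W)"
proof -
  have "(\<Sum>y\<in>range Leaf. case y of Leaf a \<Rightarrow> W a x | _ \<Rightarrow> 0) = 1" for x
    by (subst sum.reindex) (auto simp: inj_on_def W_sum)
  then show ?thesis
    by (auto simp: bdmc_def base_chan_def W_nonneg)
qed

lemma bdmc_synth: "bdmc (synth n j)"
proof -
  have "bdmc (chanr m (base_chan W) t)" for t
  proof (induction "length t" arbitrary: t rule: less_induct)
    case less
    show ?case
    proof (cases t)
      case Nil
      then show ?thesis by (simp add: bdmc_base_chan)
    next
      case (Cons a r)
      then have "bdmc (chanr m (base_chan W) r)" "bdmc (chanr m (base_chan W) (drop (m - 1) r))"
        using less by auto
      then show ?thesis
        using Cons by (auto split: sym.split intro: bdmc_bplus bdmc_bminus)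
    qed
  qed
  then show ?thesis by (simp add: synth_def Wt_def)
qed

text \<open>By the chain rule the total information obeys the recursion of the sizes, starting from
  the base channel alone.\<close>

lemma sum_symI_synth: "(\<Sum>j\<in>{1..Nseq m n}. symI (synth n j)) = Nseq m n * symI (base_chan W)"
proof (induction n rule: less_induct)
  case (less n)
  show ?case
  proof (cases n)
    case 0
    then show ?thesis by (simp add: synth_def Wt_def)
  next
    case (Suc n')
    let ?q = "n' - (m - 1)"
    have "(\<Sum>j\<in>{1..Nseq m n}. symI (synth n j))
        = (\<Sum>j\<in>{1..Nseq m ?q}. symI (synth (Suc n') j) + symI (synth (Suc n') (j + Nseq m n')))
        + (\<Sum>j\<in>{Nseq m ?q<..Nseq m n'}. symI (synth (Suc n') j))"
      unfolding Suc by (rule sum_generation)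
    also have "\<dots> = (\<Sum>j\<in>{1..Nseq m ?q}. symI (synth ?q j) + symI (synth n' j))
        + (\<Sum>j\<in>{Nseq m ?q<..Nseq m n'}. symI (synth n' j))"
      by (intro arg_cong2[where f = "(+)", OF sum.cong sum.cong] refl)
        (simp_all only: synth_Suc synth_Suc_star symI_bplus_bminus bdmc_synth)
    also have "\<dots> = (\<Sum>j\<in>{1..Nseq m ?q}. symI (synth ?q j)) + (\<Sum>j\<in>{1..Nseq m n'}. symI (synth n' j))"
      using sum_to_Nseq_split[of ?q n' "\<lambda>j. symI (synth n' j)" m] by (simp add: sum.distrib)
    also have "\<dots> = Nseq m n * symI (base_chan W)"
      using less[of ?q] less[of n'] by (simp add: Suc distrib_right)
    finally show ?thesis .
  qed
qed

lemma memory_recursion_bhat: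
  assumes "1 \<le> m"
  shows "memory_recursion m (\<lambda>n j. bhat (synth n j))"
  by unfold_locales
    (simp_all only: assms bhat_nonneg bhat_le_1 bdmc_synth synth_Suc synth_Suc_star bhat_bplus bhat_bminus_le)

lemma symI_middle_tendsto_0:
  assumes "1 \<le> m" "0 < e"
  shows "(\<lambda>n. card {j \<in> {1..Nseq m n}. e \<le> symI (synth n j) \<and> symI (synth n j) \<le> 1 - e} / Nseq m n) \<longlonglongrightarrow> 0"
proof (rule tendsto_sandwich[OF _ _ tendsto_const])
  interpret memory_recursion m "\<lambda>n j. bhat (synth n j)"
    by (rule memory_recursion_bhat[OF assms(1)])
  \<comment> \<open>The factor \<open>ln 2 / 2\<close> undoes the constant \<open>2 / ln 2\<close>
    in the comparisons of \<open>symI\<close> with \<open>bhat\<close>.\<close>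
  define \<epsilon> where "\<epsilon> = e * ln 2 / 2"
  have "0 < \<epsilon>"
    using assms by (simp add: \<epsilon>_def)
  then show "(\<lambda>n. card {j \<in> {1..Nseq m n}. \<epsilon> \<le> bhat (synth n j) \<and> bhat (synth n j) \<le> 1 - \<epsilon>} / Nseq m n) \<longlonglongrightarrow> 0"
    by (rule unpolarized_tendsto_0)
  have imp: "\<epsilon> \<le> b" if "e \<le> 2 / ln 2 * b" for b
    using that by (simp add: \<epsilon>_def field_simps)
  have "\<epsilon> \<le> bhat (synth n j) \<and> bhat (synth n j) \<le> 1 - \<epsilon>"
    if "e \<le> symI (synth n j)" "symI (synth n j) \<le> 1 - e" for n j
    using imp[of "bhat (synth n j)"] imp[of "1 - bhat (synth n j)"] that
      symI_le_bhat[OF bdmc_synth, of n j] one_minus_symI_le_bhat[OF bdmc_synth, of n j] by simp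
  then show "\<forall>\<^sub>F n in sequentially.
      card {j \<in> {1..Nseq m n}. e \<le> symI (synth n j) \<and> symI (synth n j) \<le> 1 - e} / real (Nseq m n)
      \<le> card {j \<in> {1..Nseq m n}. \<epsilon> \<le> bhat (synth n j) \<and> bhat (synth n j) \<le> 1 - \<epsilon>} / real (Nseq m n)"
    by (intro always_eventually allI divide_right_mono of_nat_mono card_mono) auto
qed auto

end

end

theorem theorem1:
  fixes m :: nat and W :: "'y::finite \<Rightarrow> bool \<Rightarrow> real" and \<delta> :: real
  assumes "m \<ge> 1"
    and "\<And>y x. W y x \<ge> 0"
    and "\<And>x. (\<Sum>y\<in>UNIV. W y x) = 1"
    and "0 < \<delta>" and "\<delta> < 1"
  shows "(\<lambda>n. real (card {s \<in> Sset m n. symI (Wt m W s) \<in> {1 - \<delta><..1}}) / real (Nseq m n))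
           \<longlonglongrightarrow> symI (base_chan W)
       \<and> (\<lambda>n. real (card {s \<in> Sset m n. symI (Wt m W s) \<in> {0..<\<delta>}}) / real (Nseq m n))
           \<longlonglongrightarrow> 1 - symI (base_chan W)"
proof
  let ?I = "\<lambda>n j. symI (synth m W n j)"
  note bdmc = bdmc_synth[of W, OF assms(2,3)]
  have middle: "(\<lambda>n. card {j \<in> {1..Nseq m n}. e \<le> ?I n j \<and> ?I n j \<le> 1 - e} / Nseq m n) \<longlonglongrightarrow> 0"
    if "0 < e" for e
    by (rule symI_middle_tendsto_0) (use assms that in auto)
  have mean: "(\<Sum>j\<in>{1..Nseq m n}. ?I n j) = Nseq m n * symI (base_chan W)" for n
    by (rule sum_symI_synth) (use assms in auto)
  have range: "0 \<le> ?I n j" "?I n j \<le> 1" for n j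
    by (auto intro: symI_nonneg symI_le_1 bdmc)
  have "(\<lambda>n. card {j \<in> {1..Nseq m n}. 1 - \<delta> < ?I n j} / Nseq m n) \<longlonglongrightarrow> symI (base_chan W)"
    by (rule polarized_fraction_tendsto) (use assms middle mean range Nseq_pos in auto)
  then show "(\<lambda>n. real (card {s \<in> Sset m n. symI (Wt m W s) \<in> {1 - \<delta><..1}}) / real (Nseq m n))
           \<longlonglongrightarrow> symI (base_chan W)"
    using range(2) by (simp add: card_Sset_Collect synth_def)
  \<comment> \<open>Low values of the information are high values of its complement to 1, whose mean
    is \<open>1 - symI (base_chan W)\<close>; the middle range is symmetric under this
    reflection.\<close>
  have "(\<lambda>n. card {j \<in> {1..Nseq m n}. 1 - \<delta> < 1 - ?I n j} / Nseq m n) \<longlonglongrightarrow> 1 - symI (base_chan W)"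
  proof (rule polarized_fraction_tendsto)
    show "(\<Sum>j\<in>{1..Nseq m n}. 1 - ?I n j) = Nseq m n * (1 - symI (base_chan W))" for n
      unfolding sum_subtractf mean by (simp add: algebra_simps)
    show "(\<lambda>n. card {j \<in> {1..Nseq m n}. e \<le> 1 - ?I n j \<and> 1 - ?I n j \<le> 1 - e} / Nseq m n) \<longlonglongrightarrow> 0"
      if "0 < e" for e
    proof -
      have "(e \<le> 1 - ?I n j \<and> 1 - ?I n j \<le> 1 - e) = (e \<le> ?I n j \<and> ?I n j \<le> 1 - e)" for n j
        by auto
      then show ?thesis using middle[OF that] by simp
    qed
  qed (use assms range Nseq_pos in auto)
  then show "(\<lambda>n. real (card {s \<in> Sset m n. symI (Wt m W s) \<in> {0..<\<delta>}}) / real (Nseq m n))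
           \<longlonglongrightarrow> 1 - symI (base_chan W)"
    using range(1) by (simp add: card_Sset_Collect synth_def)
qed

end
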